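(* The map $\Phi$ induces a bijection from $\mathrm{MotzPF}_n/\!\sim$ to the set $\mathrm{Motz}_n$ of Motzkin paths of length $n$.
   Context: $[n]=\{1,\dots,n\}$. A parking function of length $n$ is $p\in[n]^n$ whose non-decreasing rearrangement $a_1\le\dots\le a_n$ satisfies $a_i\le i$ for all $i$. $\mathrm{MotzPF}_n$ is the set of parking functions $p$ of length $n$ such that $|\{i:p_i=j\}|\le 2$ for every $j\in[n]$. For $p,p'\in\mathrm{MotzPF}_n$, $p\sim p'$ if $p'$ is obtained by permuting the entries of $p$. For $p\in[n]^n$, $\Phi(p)=\phi_1\cdots\phi_n$ is the lattice path with steps $\phi_j=U=(1,1)$ if $|\{i:p_i=j\}|\ge2$, $\phi_j=H=(1,0)$ if $|\{i:p_i=j\}|=1$, $\phi_j=D=(1,-1)$ if $|\{i:p_i=j\}|=0$; it is constant on $\sim$-classes. $\mathrm{Motz}_n$ is the set of lattice paths from $(0,0)$ to $(n,0)$ with steps $U,H,D$ never going below the $x$-axis. *)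

theory Defs
  imports Main "HOL-Library.Product_Plus" "HOL-Combinatorics.Permutations"
begin

text \<open>A tuple \<open>(p\<^sub>1, \<dots>, p\<^sub>n)\<close> is a list of length \<open>n\<close>; the entry \<open>p\<^sub>i\<close> is \<open>p ! (i - 1)\<close>.\<close>

definition tuples :: "nat \<Rightarrow> nat list set" where
  "tuples n = {p. length p = n \<and> set p \<subseteq> {1..n}}"

definition parking_functions :: "nat \<Rightarrow> nat list set" where
  "parking_functions n = {p \<in> tuples n. \<forall>i\<in>{1..n}. sort p ! (i - 1) \<le> i}"

definition mult :: "nat list \<Rightarrow> nat \<Rightarrow> nat" where
  "mult p j = card {i \<in> {..<length p}. p ! i = j}"

definition MotzPF :: "nat \<Rightarrow> nat list set" where
  "MotzPF n = {p \<in> parking_functions n. \<forall>j\<in>{1..n}. mult p j \<le> 2}"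

definition perm_rel :: "nat \<Rightarrow> (nat list \<times> nat list) set" where
  "perm_rel n = {(p, p'). p \<in> MotzPF n \<and> p' \<in> MotzPF n \<and>
     (\<exists>\<sigma>. \<sigma> permutes {..<n} \<and> p' = permute_list \<sigma> p)}"

datatype step = U | H | D

fun step_vec :: "step \<Rightarrow> int \<times> int" where
  "step_vec U = (1, 1)"
| "step_vec H = (1, 0)"
| "step_vec D = (1, -1)"

text \<open>The lattice point reached from the origin after the steps of \<open>w\<close>.\<close>

definition endpoint :: "step list \<Rightarrow> int \<times> int" where
  "endpoint w = sum_list (map step_vec w)"

definition Motz :: "nat \<Rightarrow> step list set" where
  "Motz n = {w. endpoint w = (int n, 0) \<and> (\<forall>k\<le>length w. 0 \<le> snd (endpoint (take k w)))}"

definition Phi :: "nat \<Rightarrow> nat list \<Rightarrow> step list" where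
  "Phi n p = map (\<lambda>j. if mult p j \<ge> 2 then U else if mult p j = 1 then H else D) [1..<n+1]"

text \<open>The map on equivalence classes induced by \<open>f\<close>: on a class \<open>C\<close> on which \<open>f\<close> is constant,
  it returns the unique element of \<open>f ` C\<close>.\<close>

definition induced :: "('a \<Rightarrow> 'b) \<Rightarrow> 'a set \<Rightarrow> 'b" where
  "induced f C = the_elem (f ` C)"

lemma perm_rel_iff_mset:
  "(p, p') \<in> perm_rel n \<longleftrightarrow> p \<in> MotzPF n \<and> p' \<in> MotzPF n \<and> mset p = mset p'"
proof -
  have "(\<exists>\<sigma>. \<sigma> permutes {..<n} \<and> p' = permute_list \<sigma> p) \<longleftrightarrow> mset p = mset p'"
    if "p \<in> MotzPF n" "p' \<in> MotzPF n"
  proof -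
    have len: "length p = n" "length p' = n"
      using that by (auto simp: MotzPF_def parking_functions_def tuples_def)
    show ?thesis
    proof
      assume "\<exists>\<sigma>. \<sigma> permutes {..<n} \<and> p' = permute_list \<sigma> p"
      then show "mset p = mset p'" using len by auto
    next
      assume "mset p = mset p'"
      then show "\<exists>\<sigma>. \<sigma> permutes {..<n} \<and> p' = permute_list \<sigma> p"
        using len by (metis mset_eq_permutation)
    qed
  qed
  then show ?thesis by (auto simp: perm_rel_def)
qed

lemma equiv_perm_rel: "equiv (MotzPF n) (perm_rel n)"
  by (rule equivI) (auto simp: refl_on_def sym_def trans_def perm_rel_iff_mset)

end

theory Submission
  imports Defs
begin

text \<open>
  A step records the multiplicity \<open>2, 1, 0\<close> of a value as \<open>U, H, D\<close>, that is, as its height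
  change plus one. Hence the height of \<open>\<Phi>(p)\<close> after \<open>k\<close> steps is the number of entries of \<open>p\<close>
  that are at most \<open>k\<close>, minus \<open>k\<close>; that all these heights are nonnegative is precisely the
  parking condition. The multiplicities determine the entries up to order, and every word in
  \<open>U, H, D\<close> arises from some choice of multiplicities.
\<close>

fun step_mult :: "step \<Rightarrow> nat" where
  "step_mult U = 2"
| "step_mult H = 1"
| "step_mult D = 0"

lemma mult_eq_count: "mult p j = count (mset p) j"
  by (simp add: mult_def count_mset count_list_eq_length_filter length_filter_conv_card
      lessThan_def eq_commute)

lemma snd_step_vec: "snd (step_vec s) = int (step_mult s) - 1"
  by (cases s) auto

text \<open>Every step moves one unit to the right. \<open>Motz\<close> fixes only the endpoint, so
  this is how the length of a path is recovered.\<close>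

lemma fst_endpoint: "fst (endpoint w) = int (length w)"
proof (induction w)
  case (Cons s w)
  then show ?case by (cases s) (auto simp: endpoint_def)
qed (simp add: endpoint_def)

lemma endpoint_take_Suc:
  "k < length w \<Longrightarrow> endpoint (take (Suc k) w) = endpoint (take k w) + step_vec (w ! k)"
  by (simp add: endpoint_def take_Suc_conv_app_nth)

lemma length_filter_le_Suc:
  fixes p :: "nat list"
  shows "length (filter (\<lambda>x. x \<le> Suc k) p) = length (filter (\<lambda>x. x \<le> k) p) + count (mset p) (Suc k)"
  by (induction p) auto

text \<open>In a sorted list the entries at most \<open>m\<close> form a prefix, and
  \<open>k\<close> indexes into that prefix exactly when it is below the prefix's length.\<close>

lemma sorted_nth_le_iff:
  fixes xs :: "'a::linorder list"
  assumes "sorted xs" "k < length xs"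
  shows "xs ! k \<le> m \<longleftrightarrow> k < length (filter (\<lambda>x. x \<le> m) xs)"
  using assms
proof (induction xs arbitrary: k)
  case (Cons x xs)
  show ?case
  proof (cases "x \<le> m")
    case True
    then show ?thesis using Cons by (cases k) auto
  next
    case False
    then have "\<forall>y\<in>set (x # xs). \<not> y \<le> m" using Cons.prems(1) by auto
    then have "filter (\<lambda>y. y \<le> m) (x # xs) = []" and "\<not> (x # xs) ! k \<le> m"
      using Cons.prems(2) by (metis filter_False, metis nth_mem)
    then show ?thesis by simp
  qed
qed simp

text \<open>Replaces the sorted rearrangement by counts, which can be compared with path heights.
  The added case \<open>k = 0\<close> is trivial.\<close>

lemma parking_functions_iff:
  assumes "p \<in> tuples n"
  shows "p \<in> parking_functions n \<longleftrightarrow> (\<forall>k\<le>n. k \<le> length (filter (\<lambda>x. x \<le> k) p))"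
proof -
  have len: "length p = n" using assms by (simp add: tuples_def)
  have "sort p ! (k - 1) \<le> k \<longleftrightarrow> k \<le> length (filter (\<lambda>x. x \<le> k) p)" if "k \<in> {1..n}" for k
  proof -
    have "length (filter (\<lambda>x. x \<le> k) (sort p)) = length (filter (\<lambda>x. x \<le> k) p)"
      by (metis mset_filter mset_sort size_mset)
    then have "sort p ! (k - 1) \<le> k \<longleftrightarrow> k - 1 < length (filter (\<lambda>x. x \<le> k) p)"
      using sorted_nth_le_iff[of "sort p" "k - 1" k] that len by fastforce
    then show ?thesis using that by auto
  qed
  then have "p \<in> parking_functions n \<longleftrightarrow> (\<forall>k\<in>{1..n}. k \<le> length (filter (\<lambda>x. x \<le> k) p))"
    using assms by (simp add: parking_functions_def)
  also have "\<dots> \<longleftrightarrow> (\<forall>k\<le>n. k \<le> length (filter (\<lambda>x. x \<le> k) p))"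
    by (metis atLeastAtMost_iff le0 less_one not_le)
  finally show ?thesis .
qed

lemma length_Phi [simp]: "length (Phi n p) = n"
  by (simp add: Phi_def)

text \<open>\<open>Phi\<close> sends every multiplicity above 1 to \<open>U\<close>, so the bound 2
  is what makes the step determine the multiplicity. The step at index \<open>k\<close> belongs to
  the value \<open>Suc k\<close>.\<close>

lemma step_mult_Phi_nth:
  "\<lbrakk>k < n; mult p (Suc k) \<le> 2\<rbrakk> \<Longrightarrow> step_mult (Phi n p ! k) = mult p (Suc k)"
  by (auto simp: Phi_def simp del: upt_Suc)

lemma height_Phi:
  assumes "p \<in> tuples n" "\<forall>j\<in>{1..n}. mult p j \<le> 2" "k \<le> n"
  shows "snd (endpoint (take k (Phi n p))) = int (length (filter (\<lambda>x. x \<le> k) p)) - int k"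
  using assms(3)
proof (induction k)
  case 0
  \<comment> \<open>Entries of a tuple start at 1.\<close>
  have "filter (\<lambda>x. x \<le> 0) p = []"
    using assms(1) by (auto simp: tuples_def filter_empty_conv)
  then show ?case by (simp add: endpoint_def)
next
  case (Suc k)
  then have "step_mult (Phi n p ! k) = mult p (Suc k)"
    using assms(2) by (intro step_mult_Phi_nth) auto
  then show ?case
    using Suc by (simp add: endpoint_take_Suc snd_step_vec length_filter_le_Suc mult_eq_count)
qed

text \<open>All \<open>n\<close> entries are at most \<open>n\<close>, so the path always ends at
  height 0; only nonnegativity of the heights is left to compare.\<close>

lemma Phi_in_Motz_iff:
  assumes "p \<in> tuples n" "\<forall>j\<in>{1..n}. mult p j \<le> 2"
  shows "Phi n p \<in> Motz n \<longleftrightarrow> p \<in> parking_functions n"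
proof -
  have "filter (\<lambda>x. x \<le> n) p = p" "length p = n"
    using assms(1) by (auto simp: tuples_def filter_id_conv)
  then have "snd (endpoint (Phi n p)) = 0"
    using height_Phi[OF assms, of n] by simp
  then have "endpoint (Phi n p) = (int n, 0)"
    by (simp add: prod_eq_iff fst_endpoint)
  then show ?thesis
    using assms by (simp add: Motz_def height_Phi parking_functions_iff)
qed

lemma mset_eq_if_Phi_eq:
  assumes "p \<in> MotzPF n" "q \<in> MotzPF n" "Phi n p = Phi n q"
  shows "mset p = mset q"
proof (rule multiset_eqI)
  fix j
  show "count (mset p) j = count (mset q) j"
  proof (cases "j \<in> {1..n}")
    case True
    then obtain k where k: "j = Suc k" "k < n" by (cases j) auto
    have "mult p j \<le> 2" "mult q j \<le> 2"
      using assms True by (auto simp: MotzPF_def)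
    then have "mult p j = mult q j"
      using step_mult_Phi_nth[of k n] k assms(3) by metis
    then show ?thesis by (simp add: mult_eq_count)
  next
    case False
    then have "j \<notin> set p" "j \<notin> set q"
      using assms by (auto simp: MotzPF_def parking_functions_def tuples_def)
    then show ?thesis by (metis count_eq_zero_iff set_mset_mset)
  qed
qed

text \<open>The non-decreasing representative of the class that \<open>Phi\<close> should send to
  \<open>w\<close>.\<close>

definition list_of_path :: "step list \<Rightarrow> nat list" where
  "list_of_path w = concat (map (\<lambda>k. replicate (step_mult (w ! k)) (Suc k)) [0..<length w])"

text \<open>Summing the height changes shows that a path returning to height 0 yields a list as long
  as the path, hence a tuple.\<close>

lemma length_list_of_path: "int (length (list_of_path w)) = snd (endpoint w) + int (length w)"
proof -
  have "snd (endpoint (take k w)) = int (\<Sum>i<k. step_mult (w ! i)) - int k" if "k \<le> length w" for k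
    using that
    by (induction k) (simp_all add: endpoint_take_Suc snd_step_vec, simp add: endpoint_def)
  from this[of "length w"] show ?thesis
    by (simp add: list_of_path_def length_concat o_def interv_sum_list_conv_sum_set_nat
        atLeast0LessThan)
qed

lemma set_list_of_path: "set (list_of_path w) \<subseteq> {1..length w}"
  by (auto simp: list_of_path_def)

lemma mult_list_of_path:
  assumes "k < length w"
  shows "mult (list_of_path w) (Suc k) = step_mult (w ! k)"
proof -
  have "count (mset (list_of_path w)) (Suc k)
      = (\<Sum>i<length w. length (filter ((=) (Suc k)) (replicate (step_mult (w ! i)) (Suc i))))"
    by (simp add: list_of_path_def count_mset count_list_eq_length_filter filter_concat
        length_concat o_def interv_sum_list_conv_sum_set_nat atLeast0LessThan)
  \<comment> \<open>Only the block of index \<open>k\<close> contains the value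
    \<open>Suc k\<close>.\<close>
  also have "\<dots> = (\<Sum>i<length w. if i = k then step_mult (w ! i) else 0)"
    by (rule sum.cong) (auto simp: filter_replicate)
  finally show ?thesis using assms by (simp add: mult_eq_count)
qed

lemma Phi_surj:
  assumes "w \<in> Motz n"
  shows "\<exists>p\<in>MotzPF n. Phi n p = w"
proof -
  have ep: "endpoint w = (int n, 0)" using assms by (simp add: Motz_def)
  have len: "length w = n" using fst_endpoint[of w] ep by simp
  let ?p = "list_of_path w"
  have tup: "?p \<in> tuples n"
    using length_list_of_path[of w] set_list_of_path[of w] ep len by (simp add: tuples_def)
  have mult: "mult ?p (Suc k) = step_mult (w ! k)" if "k < n" for k
    using mult_list_of_path that len by blast
  have le2: "\<forall>j\<in>{1..n}. mult ?p j \<le> 2"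
  proof
    fix j assume "j \<in> {1..n}"
    then obtain k where "j = Suc k" "k < n" by (cases j) auto
    then show "mult ?p j \<le> 2" using mult[of k] by (cases "w ! k") auto
  qed
  have "Phi n ?p = w"
  proof (rule nth_equalityI)
    fix k assume "k < length (Phi n ?p)"
    then show "Phi n ?p ! k = w ! k"
      using mult[of k] by (cases "w ! k") (auto simp: Phi_def simp del: upt_Suc)
  qed (simp add: len)
  \<comment> \<open>As \<open>w\<close> is a Motzkin path, the equivalence read from left to right
    gives the parking condition.\<close>
  moreover from this have "?p \<in> MotzPF n"
    using Phi_in_Motz_iff[OF tup le2] assms le2 by (simp add: MotzPF_def)
  ultimately show ?thesis by blast
qed

text \<open>The image of a class under a map constant on it is a singleton, so
  \<open>the_elem\<close> is well defined there.\<close>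

lemma induced_class:
  assumes "equiv A r" "f respects r" "x \<in> A"
  shows "induced f (r `` {x}) = f x"
proof -
  have "f ` (r `` {x}) = {f x}"
    using assms equiv_class_self[OF assms(1,3)] by (force simp: congruent_def)
  then show ?thesis by (simp add: induced_def)
qed

theorem theorem3p4:
  fixes n :: nat
  shows "(Phi n) respects (perm_rel n) \<and>
         bij_betw (induced (Phi n)) (MotzPF n // perm_rel n) (Motz n)"
proof
  show resp: "(Phi n) respects (perm_rel n)"
    by (auto simp: congruent_def perm_rel_iff_mset Phi_def mult_eq_count)
  note induced = induced_class[OF equiv_perm_rel resp]
  show "bij_betw (induced (Phi n)) (MotzPF n // perm_rel n) (Motz n)"
  proof (rule bij_betw_imageI)
    show "inj_on (induced (Phi n)) (MotzPF n // perm_rel n)"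
    proof (rule inj_onI)
      fix C C'
      assume "C \<in> MotzPF n // perm_rel n" "C' \<in> MotzPF n // perm_rel n"
        and eq: "induced (Phi n) C = induced (Phi n) C'"
      then obtain p p' where p: "p \<in> MotzPF n" "C = perm_rel n `` {p}"
        and p': "p' \<in> MotzPF n" "C' = perm_rel n `` {p'}"
        by (metis quotientE)
      then have "mset p = mset p'"
        using eq induced by (intro mset_eq_if_Phi_eq) auto
      then have "(p, p') \<in> perm_rel n" using p p' by (simp add: perm_rel_iff_mset)
      then show "C = C'" using p p' equiv_class_eq[OF equiv_perm_rel] by blast
    qed
    \<comment> \<open>Evaluating on representatives turns surjectivity on classes into a statement
      about \<open>Phi\<close> itself.\<close>
    have "induced (Phi n) ` (MotzPF n // perm_rel n) = Phi n ` MotzPF n"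
      by (simp add: quotient_def UNION_singleton_eq_range image_image induced)
    also have "\<dots> = Motz n"
    proof
      show "Phi n ` MotzPF n \<subseteq> Motz n"
        using Phi_in_Motz_iff by (auto simp: MotzPF_def parking_functions_def)
      show "Motz n \<subseteq> Phi n ` MotzPF n"
        using Phi_surj by blast
    qed
    finally show "induced (Phi n) ` (MotzPF n // perm_rel n) = Motz n" .
  qed
qed

end
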